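(* Let $(l_n)_{n \geq 1}$ be a decreasing sequence of real numbers in $(0,1)$, and let $\varepsilon$ be a real number with $0 < \varepsilon < 1 - l_1$. Suppose that $\sum_{n=1}^\infty l_n^2$ diverges. Then \[ \lim_{n\to\infty} \int_0^\varepsilon \prod_{k=1}^n \frac{1 - l_k - \min\{l_k, t\}}{(1 - l_k)^2} \, \mathrm{d} t = \infty. \] *)

theory Defs
  imports "HOL-Analysis.Analysis"
begin

end

theory Submission
  imports Defs
begin

text \<open>
  Each factor of the integrand equals
  \<open>1 + (l\<^sub>k (1 - l\<^sub>k) - min l\<^sub>k t) / (1 - l\<^sub>k)\<^sup>2\<close>, so it is larger than 1 for small \<open>t\<close> and
  smaller than 1 for larger \<open>t\<close>. What matters is its average over \<open>[0, d]\<close>: when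
  \<open>l\<^sub>k \<le> d\<close>, the average of \<open>l\<^sub>k - min l\<^sub>k t\<close> is \<open>l\<^sub>k\<^sup>2 / (2d)\<close>, which beats the loss \<open>l\<^sub>k\<^sup>2\<close> as
  soon as \<open>d < 1/2\<close>. Hence for a suitably small fixed \<open>d\<close> every factor has average at least
  \<open>1 + c l\<^sub>k\<^sup>2\<close>, with \<open>c > 0\<close> independent of \<open>k\<close> (lemma \<open>factor_integral_ge\<close>).

  The integrand cannot be averaged factor by factor, but all factors decrease in \<open>t\<close>, so they are
  positively correlated: by Chebyshev's inequality (lemmas \<open>Chebyshev_integral\<close> and
  \<open>Chebyshev_integral_prod\<close>) the average of the product is at least the product of the averages,
  that is at least \<open>\<Prod>(1 + c l\<^sub>k\<^sup>2) \<ge> c \<Sum> l\<^sub>k\<^sup>2\<close>. The integrand is nonnegative on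
  \<open>[0, \<epsilon>]\<close>, so shrinking the interval to \<open>[0, d]\<close> only lowers the integral.
\<close>

text \<open>
  The continuous function \<open>g\<close> attains its mean at some \<open>c\<close>. By monotonicity
  \<open>(f t - f c) (g t - g c) \<ge> 0\<close> for all \<open>t\<close>, and integrating this makes the terms with \<open>f c\<close>
  cancel.
\<close>
lemma Chebyshev_integral:
  fixes f g :: "real \<Rightarrow> real"
  assumes ab: "a < b"
    and f: "continuous_on {a..b} f" "antimono_on {a..b} f"
    and g: "continuous_on {a..b} g" "antimono_on {a..b} g"
  shows "integral {a..b} f * integral {a..b} g \<le> (b - a) * integral {a..b} (\<lambda>t. f t * g t)"
proof -
  define m where "m = integral {a..b} g / (b - a)"
  have gint: "g integrable_on {a..b}" and fint: "f integrable_on {a..b}"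
    and fgint: "(\<lambda>t. f t * g t) integrable_on {a..b}"
    using f g by (auto intro!: integrable_continuous_interval continuous_intros)
  have G: "integral {a..b} g = m * (b - a)"
    using ab by (simp add: m_def)
  have "integral {a..b} (\<lambda>t. g b) \<le> integral {a..b} g"
    by (rule integral_le) (use gint g(2) ab in \<open>auto simp: monotone_on_def\<close>)
  hence gb: "g b \<le> m"
    using ab by (simp add: m_def field_simps)
  have "integral {a..b} g \<le> integral {a..b} (\<lambda>t. g a)"
    by (rule integral_le) (use gint g(2) ab in \<open>auto simp: monotone_on_def\<close>)
  hence ga: "m \<le> g a"
    using ab by (simp add: m_def field_simps)
  obtain c where c: "a \<le> c" "c \<le> b" "g c = m"
    using IVT2'[of g b m a] gb ga ab g(1) by auto
  have "0 \<le> integral {a..b} (\<lambda>t. (f t * g t - m * f t) - (f c * g t - f c * m))"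
  proof (rule integral_nonneg)
    show "(\<lambda>t. (f t * g t - m * f t) - (f c * g t - f c * m)) integrable_on {a..b}"
      using f g by (auto intro!: integrable_continuous_interval continuous_intros)
    fix t assume t: "t \<in> {a..b}"
    have "0 \<le> (f t - f c) * (g t - g c)"
      using f(2) g(2) t c by (cases "t \<le> c") (auto simp: monotone_on_def zero_le_mult_iff)
    thus "0 \<le> (f t * g t - m * f t) - (f c * g t - f c * m)"
      by (simp add: c algebra_simps)
  qed
  also have "\<dots> = integral {a..b} (\<lambda>t. f t * g t - m * f t)
      - integral {a..b} (\<lambda>t. f c * g t - f c * m)"
    using f g by (intro integral_diff integrable_continuous_interval continuous_intros) auto
  also have "integral {a..b} (\<lambda>t. f c * g t - f c * m)
      = integral {a..b} (\<lambda>t. f c * g t) - integral {a..b} (\<lambda>t. f c * m)"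
    using f g by (intro integral_diff integrable_continuous_interval continuous_intros) auto
  also have "\<dots> = 0"
    using G ab by simp
  also have "integral {a..b} (\<lambda>t. f t * g t - m * f t)
      = integral {a..b} (\<lambda>t. f t * g t) - integral {a..b} (\<lambda>t. m * f t)"
    using f g by (intro integral_diff integrable_continuous_interval continuous_intros) auto
  finally have "m * integral {a..b} f \<le> integral {a..b} (\<lambda>t. f t * g t)"
    by simp
  hence "(b - a) * (m * integral {a..b} f) \<le> (b - a) * integral {a..b} (\<lambda>t. f t * g t)"
    using ab by (intro mult_left_mono) auto
  thus ?thesis
    by (simp add: G mult_ac)
qed

text \<open>
  Nonnegativity of the factors is what keeps the partial products decreasing, so that the
  two-function inequality can be iterated.
\<close>
lemma Chebyshev_integral_prod:
  fixes q :: "'i \<Rightarrow> real \<Rightarrow> real"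
  assumes "a < b" "finite K"
    and cont: "\<And>k. k \<in> K \<Longrightarrow> continuous_on {a..b} (q k)"
    and anti: "\<And>k. k \<in> K \<Longrightarrow> antimono_on {a..b} (q k)"
    and nonneg: "\<And>k t. k \<in> K \<Longrightarrow> t \<in> {a..b} \<Longrightarrow> 0 \<le> q k t"
    and mean: "\<And>k. k \<in> K \<Longrightarrow> (b - a) * m k \<le> integral {a..b} (q k)"
    and m: "\<And>k. k \<in> K \<Longrightarrow> 0 \<le> m k"
  shows "(b - a) * (\<Prod>k\<in>K. m k) \<le> integral {a..b} (\<lambda>t. \<Prod>k\<in>K. q k t)"
  using \<open>finite K\<close> cont anti nonneg mean m
proof (induction K rule: finite_induct)
  case empty
  then show ?case using \<open>a < b\<close> by simp
next
  case (insert k K)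
  let ?P = "\<lambda>t. \<Prod>k\<in>K. q k t"
  have IH: "(b - a) * prod m K \<le> integral {a..b} ?P"
    using insert.prems by (intro insert.IH) auto
  have Pcont: "continuous_on {a..b} ?P"
    using insert.prems(1) by (intro continuous_intros) auto
  have Panti: "antimono_on {a..b} ?P"
    using insert.prems(2,3) by (fastforce simp: monotone_on_def intro!: prod_mono)
  have "((b - a) * m k) * ((b - a) * prod m K) \<le> integral {a..b} (q k) * integral {a..b} ?P"
  proof (rule mult_mono)
    show "0 \<le> integral {a..b} (q k)"
      using insert.prems by (intro integral_nonneg integrable_continuous_interval) auto
    show "0 \<le> (b - a) * prod m K"
      using insert.prems(5) \<open>a < b\<close> by (auto intro!: mult_nonneg_nonneg prod_nonneg)
  qed (use IH insert.prems(4) in auto)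
  also have "\<dots> \<le> (b - a) * integral {a..b} (\<lambda>t. q k t * ?P t)"
    using insert.prems Pcont Panti \<open>a < b\<close> by (intro Chebyshev_integral) auto
  finally have "(b - a) * ((b - a) * (m k * prod m K))
      \<le> (b - a) * integral {a..b} (\<lambda>t. q k t * ?P t)"
    by (simp add: mult_ac)
  thus ?case
    using \<open>a < b\<close> insert.hyps by simp
qed

lemma integral_min_le:
  fixes x d :: real
  assumes "0 < x" "x \<le> d"
  shows "integral {0..d} (min x) = x * d - x\<^sup>2 / 2"
proof -
  have "(min x has_integral x\<^sup>2 / 2 - 0\<^sup>2 / 2) {0..x}"
  proof (rule has_integral_eq[OF _ fundamental_theorem_of_calculus])
    show "((\<lambda>t. t\<^sup>2 / 2) has_vector_derivative t) (at t within {0..x})" for t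
      by (auto simp: has_real_derivative_iff_has_vector_derivative[symmetric]
               intro!: derivative_eq_intros)
  qed (use assms in auto)
  moreover have "(min x has_integral (d - x) * x) {x..d}"
    by (rule has_integral_eq[of _ "\<lambda>_. x"])
       (use has_integral_const_real[of x x d] assms in auto)
  ultimately have "(min x has_integral x\<^sup>2 / 2 - 0\<^sup>2 / 2 + (d - x) * x) {0..d}"
    using assms by (intro has_integral_combine[of 0 x d]) auto
  thus ?thesis
    by (simp add: integral_unique algebra_simps power2_eq_square)
qed

lemma integral_min_ge:
  fixes x d :: real
  assumes "0 < d" "d \<le> x"
  shows "integral {0..d} (min x) = d\<^sup>2 / 2"
proof -
  have "(min x has_integral d\<^sup>2 / 2 - 0\<^sup>2 / 2) {0..d}"
  proof (rule has_integral_eq[OF _ fundamental_theorem_of_calculus])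
    show "((\<lambda>t. t\<^sup>2 / 2) has_vector_derivative t) (at t within {0..d})" for t
      by (auto simp: has_real_derivative_iff_has_vector_derivative[symmetric]
               intro!: derivative_eq_intros)
  qed (use assms in auto)
  thus ?thesis
    by (simp add: integral_unique)
qed

text \<open>
  The gain \<open>x (1 - x)\<close> must exceed the mean of \<open>min x t\<close> by a multiple of \<open>x\<^sup>2\<close>. That mean is
  \<open>x - x\<^sup>2 / (2d)\<close> for \<open>x \<le> d\<close> and \<open>d / 2\<close> for \<open>x \<ge> d\<close>; in the second case the gain could be
  lost only for \<open>x\<close> near 1, and the bound \<open>x \<le> 1 - a\<close> together with \<open>d \<le> a / 4\<close> excludes this.
\<close>
lemma factor_integral_ge:
  fixes x a d :: real
  assumes x: "0 < x" "x \<le> 1 - a" and a: "0 < a" and d: "0 < d" "d \<le> a / 4"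
  shows "d * (1 + a / 8 * x\<^sup>2) \<le> integral {0..d} (\<lambda>t. (1 - x - min x t) / (1 - x)\<^sup>2)"
proof -
  let ?I = "integral {0..d} (min x)"
  have excess: "d * (a / 8 * x\<^sup>2) \<le> d * (x * (1 - x)) - ?I"
  proof (cases "x \<le> d")
    case True
    have "d * (a / 8) * x\<^sup>2 \<le> (1/4) * (1/8) * x\<^sup>2"
      using assms by (intro mult_right_mono mult_mono) auto
    also have "\<dots> \<le> (1/2 - d) * x\<^sup>2"
      using assms by (intro mult_right_mono) auto
    finally show ?thesis
      using True x(1) by (simp add: integral_min_le algebra_simps power2_eq_square)
  next
    case False
    have "a / 8 * x\<^sup>2 \<le> x * (1 - x) - d / 2"
    proof (cases "x \<le> 1/4")
      case True
      have "a / 8 * x\<^sup>2 \<le> 1 * x\<^sup>2"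
        using assms by (intro mult_right_mono) auto
      also have "x\<^sup>2 \<le> (1/2 - x) * x"
        unfolding power2_eq_square using True x by (intro mult_right_mono) auto
      also have "\<dots> \<le> x * (1 - x) - d / 2"
        using False by (simp add: algebra_simps)
      finally show ?thesis by simp
    next
      case False
      have "a / 8 * x\<^sup>2 \<le> a / 8 * 1"
        using assms by (intro mult_left_mono) (auto intro!: power_le_one)
      moreover have "(1/4) * a \<le> x * (1 - x)"
        using False assms by (intro mult_mono) auto
      ultimately show ?thesis
        using d by linarith
    qed
    hence "d * (a / 8 * x\<^sup>2) \<le> d * (x * (1 - x) - d / 2)"
      using d by (intro mult_left_mono) auto
    thus ?thesis
      using False d by (simp add: integral_min_ge algebra_simps power2_eq_square)
  qed
  have sq: "0 < (1 - x)\<^sup>2" "(1 - x)\<^sup>2 \<le> 1"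
    using assms by (auto intro!: power_le_one)
  have "d * (1 + a / 8 * x\<^sup>2) * (1 - x)\<^sup>2 = d * (1 - x)\<^sup>2 + d * (a / 8 * x\<^sup>2) * (1 - x)\<^sup>2"
    by (simp add: algebra_simps)
  also have "\<dots> \<le> d * (1 - x)\<^sup>2 + d * (a / 8 * x\<^sup>2) * 1"
    using assms sq by (intro add_left_mono mult_left_mono) auto
  also have "\<dots> \<le> d * (1 - x)\<^sup>2 + (d * (x * (1 - x)) - ?I)"
    using excess by simp
  also have "\<dots> = d * (1 - x) - ?I"
    by (simp add: algebra_simps power2_eq_square)
  also have "\<dots> = integral {0..d} (\<lambda>t. 1 - x) - ?I"
    using d by simp
  also have "\<dots> = integral {0..d} (\<lambda>t. 1 - x - min x t)"
    by (intro integral_diff[symmetric] integrable_continuous_interval continuous_intros)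
  finally have "d * (1 + a / 8 * x\<^sup>2) \<le> integral {0..d} (\<lambda>t. 1 - x - min x t) / (1 - x)\<^sup>2"
    using sq by (simp add: pos_le_divide_eq)
  thus ?thesis
    by simp
qed

theorem mainTheorem1:
  fixes l :: "nat \<Rightarrow> real" and \<epsilon> :: real
  assumes "\<And>n. n \<ge> 1 \<Longrightarrow> l n \<in> {0<..<1}"
    and "antimono_on {1..} l"
    and "0 < \<epsilon>" and "\<epsilon> < 1 - l 1"
    and "\<not> summable (\<lambda>n. (l (Suc n))\<^sup>2)"
  shows "filterlim
           (\<lambda>n. integral {0..\<epsilon>}
              (\<lambda>t. \<Prod>k=1..n. (1 - l k - min (l k) t) / (1 - l k)\<^sup>2))
           at_top sequentially"
proof -
  define a where "a = 1 - l 1"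
  define d where "d = min \<epsilon> (a / 4)"
  define q where "q k t = (1 - l k - min (l k) t) / (1 - l k)\<^sup>2" for k t
  have a: "0 < a"
    using assms(3,4) by (simp add: a_def)
  hence d: "0 < d" "d \<le> a / 4" "d \<le> \<epsilon>"
    unfolding d_def using assms(3) by (simp, intro min.cobounded2, intro min.cobounded1)
  have l: "0 < l k" "l k \<le> 1 - a" if "k \<ge> 1" for k
    using assms(1)[OF that] assms(2) that by (auto simp: a_def monotone_on_def)
  have q_cont: "continuous_on S (q k)" if "k \<ge> 1" for S k
    unfolding q_def using assms(1)[OF that] by (intro continuous_intros) auto
  have q_nonneg: "0 \<le> q k t" if "k \<ge> 1" "t \<in> {0..\<epsilon>}" for k t
    using l[OF that(1)] that(2) assms(4) unfolding q_def
    by (intro divide_nonneg_nonneg) (auto simp: a_def)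
  have q_anti: "antimono_on S (q k)" for S k
    unfolding q_def by (auto simp: monotone_on_def intro!: divide_right_mono)
  have prod_int: "(\<lambda>t. \<Prod>k=1..n. q k t) integrable_on {u..v}" for n u v
    by (intro integrable_continuous_interval continuous_intros q_cont) auto
  have bound: "d * (a / 8 * (\<Sum>k<n. (l (Suc k))\<^sup>2))
      \<le> integral {0..\<epsilon>} (\<lambda>t. \<Prod>k=1..n. q k t)" for n
  proof -
    have "a / 8 * (\<Sum>k<n. (l (Suc k))\<^sup>2) = (\<Sum>k=1..n. a / 8 * (l k)\<^sup>2)"
      by (simp add: sum_distrib_left sum.atLeast1_atMost_eq)
    also have "\<dots> \<le> (\<Prod>k=1..n. 1 + a / 8 * (l k)\<^sup>2)"
      using a by (intro sum_le_prod) auto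
    finally have "d * (a / 8 * (\<Sum>k<n. (l (Suc k))\<^sup>2))
        \<le> (d - 0) * (\<Prod>k=1..n. 1 + a / 8 * (l k)\<^sup>2)"
      using d by (simp add: mult_left_mono)
    also have "\<dots> \<le> integral {0..d} (\<lambda>t. \<Prod>k=1..n. q k t)"
    proof (rule Chebyshev_integral_prod)
      show "(d - 0) * (1 + a / 8 * (l k)\<^sup>2) \<le> integral {0..d} (q k)" if "k \<in> {1..n}" for k
        using factor_integral_ge[of "l k" a d] l[of k] a d that by (simp add: q_def[abs_def])
    qed (use a d q_cont q_nonneg q_anti in auto)
    also have "\<dots> \<le> integral {0..\<epsilon>} (\<lambda>t. \<Prod>k=1..n. q k t)"
      using d by (intro integral_subset_le prod_int) (auto intro!: prod_nonneg q_nonneg)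
    finally show ?thesis .
  qed
  have "filterlim (\<lambda>n. \<Sum>k<n. (l (Suc k))\<^sup>2) at_top sequentially"
  proof (rule ccontr)
    assume "\<not> ?thesis"
    then obtain B where B: "\<exists>\<^sub>F n in sequentially. (\<Sum>k<n. (l (Suc k))\<^sup>2) < B"
      by (auto simp: filterlim_at_top not_eventually not_le)
    have "(\<Sum>k<n. (l (Suc k))\<^sup>2) \<le> B" for n
    proof -
      obtain N where N: "N \<ge> n" "(\<Sum>k<N. (l (Suc k))\<^sup>2) < B"
        using B by (auto simp: frequently_sequentially)
      have "(\<Sum>k<n. (l (Suc k))\<^sup>2) \<le> (\<Sum>k<N. (l (Suc k))\<^sup>2)"
        using N(1) by (intro sum_mono2) auto
      thus ?thesis using N(2) by simp
    qed
    hence "summable (\<lambda>k. (l (Suc k))\<^sup>2)"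
      by (intro summableI_nonneg_bounded[where x = B]) auto
    thus False using assms(5) by contradiction
  qed
  hence "filterlim (\<lambda>n. (d * (a / 8)) * (\<Sum>k<n. (l (Suc k))\<^sup>2)) at_top sequentially"
    by (rule filterlim_tendsto_pos_mult_at_top[OF tendsto_const, rotated]) (use a d in simp)
  hence "filterlim (\<lambda>n. integral {0..\<epsilon>} (\<lambda>t. \<Prod>k=1..n. q k t)) at_top sequentially"
    by (rule filterlim_at_top_mono) (use bound in \<open>simp add: mult.assoc\<close>)
  thus ?thesis
    by (simp add: q_def)
qed

end
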